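(* Let $\pi'$ and $\pi''$ be two non-increasing tree degree sequences of the same length $n$ with $\pi'\triangleleft\pi''$. Then \[\operatorname{Ecc}(T^*_{\pi'})\geq \operatorname{Ecc}(T^*_{\pi''}),\] where $T^*_\nu$ denotes the greedy tree for degree sequence $\nu$.
   Context: For a vertex $v$ of a tree $T$, $\operatorname{ecc}_T(v)=\max_{u\in V(T)} d_T(u,v)$, and $\operatorname{Ecc}(T)=\sum_{z\in V(T)}\operatorname{ecc}_T(z)$. For non-increasing sequences $\pi'=(d'_1,\ldots,d'_n)$ and $\pi''=(d''_1,\ldots,d''_n)$, $\pi'\triangleleft\pi''$ ($\pi''$ majorizes $\pi'$) means $\sum_{i=1}^k d'_i\leq\sum_{i=1}^k d''_i$ for all $k\in[n-1]$ and $\sum_{i=1}^n d'_i=\sum_{i=1}^n d''_i$. Greedy tree for a tree degree sequence $d_1\geq\cdots\geq d_n$: the rooted tree built level by level where the root has degree $d_1$, the vertices at height 1 receive degrees $d_2,\ldots,d_{d_1+1}$, and each subsequent level (with as many vertices as the total down-degree of the previous level) receives the next largest unused degrees; within each level vertices are ordered left to right by non-increasing degree, and processing each level left to right, each vertex is joined to the first as yet unconnected vertices of the next level, as many as its down-degree (degree for the root, degree minus one otherwise). *)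

theory Defs
  imports Main "HOL-Library.Multiset"
begin

text \<open>
  A finite simple graph is given by its vertex set and its adjacency relation, a symmetric
  irreflexive set of pairs, so that walks of length \<open>k\<close> are the members of the relation power \<open>E ^^ k\<close>.
\<close>

definition simple_graph :: "'a set \<Rightarrow> ('a \<times> 'a) set \<Rightarrow> bool" where
  "simple_graph V E \<longleftrightarrow> finite V \<and> E \<subseteq> V \<times> V \<and> sym E \<and> irrefl E"

definition graph_connected :: "'a set \<Rightarrow> ('a \<times> 'a) set \<Rightarrow> bool" where
  "graph_connected V E \<longleftrightarrow> V \<noteq> {} \<and> (\<forall>u\<in>V. \<forall>v\<in>V. (u, v) \<in> E\<^sup>*)"

definition graph_cycle :: "('a \<times> 'a) set \<Rightarrow> 'a list \<Rightarrow> bool" where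
  "graph_cycle E c \<longleftrightarrow> length c \<ge> 3 \<and> distinct c \<and>
     (\<forall>i. Suc i < length c \<longrightarrow> (c ! i, c ! Suc i) \<in> E) \<and> (last c, hd c) \<in> E"

definition tree :: "'a set \<Rightarrow> ('a \<times> 'a) set \<Rightarrow> bool" where
  "tree V E \<longleftrightarrow> simple_graph V E \<and> graph_connected V E \<and> (\<nexists>c. graph_cycle E c)"

definition degree :: "('a \<times> 'a) set \<Rightarrow> 'a \<Rightarrow> nat" where
  "degree E v = card {u. (v, u) \<in> E}"

text \<open>Only meaningful for \<open>u\<close> and \<open>v\<close> in the same connected component.\<close>

definition graph_dist :: "('a \<times> 'a) set \<Rightarrow> 'a \<Rightarrow> 'a \<Rightarrow> nat" where
  "graph_dist E u v = (LEAST k. (u, v) \<in> E ^^ k)"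

definition ecc :: "'a set \<Rightarrow> ('a \<times> 'a) set \<Rightarrow> 'a \<Rightarrow> nat" where
  "ecc V E v = Max {graph_dist E u v | u. u \<in> V}"

definition Ecc :: "'a set \<Rightarrow> ('a \<times> 'a) set \<Rightarrow> nat" where
  "Ecc V E = (\<Sum>z\<in>V. ecc V E z)"

text \<open>
  Every finite tree is isomorphic to one whose vertices are natural numbers, so letting \<open>V\<close> range
  over sets of naturals loses nothing. The order of the list is not constrained here.
\<close>

definition tree_degree_sequence :: "nat list \<Rightarrow> bool" where
  "tree_degree_sequence d \<longleftrightarrow>
     (\<exists>(V :: nat set) E. tree V E \<and> image_mset (degree E) (mset_set V) = mset d)"

definition non_increasing :: "nat list \<Rightarrow> bool" where
  "non_increasing d \<longleftrightarrow> sorted_wrt (\<ge>) d"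

text \<open>\<open>majorized_by p q\<close> is \<open>p \<triangleleft> q\<close>, i.e. \<open>q\<close> majorizes \<open>p\<close>.\<close>

definition majorized_by :: "nat list \<Rightarrow> nat list \<Rightarrow> bool" where
  "majorized_by p q \<longleftrightarrow> length p = length q \<and>
     (\<forall>k\<in>{1..<length p}. sum_list (take k p) \<le> sum_list (take k q)) \<and>
     sum_list p = sum_list q"

text \<open>
  The greedy tree of a non-increasing list \<open>d\<close>. Its vertices are the indices of \<open>d\<close>, numbered level
  by level and from left to right inside a level, with vertex \<open>i\<close> receiving degree \<open>d ! i\<close>. Since \<open>d\<close>
  is non-increasing, each level thereby gets the largest degrees not used by the previous levels,
  in non-increasing order.
\<close>

definition down_degree :: "nat list \<Rightarrow> nat \<Rightarrow> nat" where
  "down_degree d i = (if i = 0 then d ! 0 else d ! i - 1)"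

text \<open>
  Level \<open>h\<close> starts at index \<open>level_start d h\<close> and ends just before \<open>level_start d (Suc h)\<close>; it has as
  many vertices as the total down-degree of the level before it.
\<close>

fun level_start :: "nat list \<Rightarrow> nat \<Rightarrow> nat" where
  "level_start d 0 = 0"
| "level_start d (Suc 0) = 1"
| "level_start d (Suc (Suc h)) =
     level_start d (Suc h) + (\<Sum>i = level_start d h..<level_start d (Suc h). down_degree d i)"

definition level :: "nat list \<Rightarrow> nat \<Rightarrow> nat set" where
  "level d h = {level_start d h..<level_start d (Suc h)}"

text \<open>
  The children of a vertex \<open>i\<close> of level \<open>h\<close> are the first \<open>down_degree d i\<close> vertices of level \<open>Suc h\<close>
  left over by the vertices of level \<open>h\<close> to the left of \<open>i\<close>.
\<close>

definition first_child :: "nat list \<Rightarrow> nat \<Rightarrow> nat \<Rightarrow> nat" where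
  "first_child d h i = level_start d (Suc h) + (\<Sum>j = level_start d h..<i. down_degree d j)"

definition greedy_child :: "nat list \<Rightarrow> nat \<Rightarrow> nat \<Rightarrow> bool" where
  "greedy_child d i j \<longleftrightarrow>
     (\<exists>h. i \<in> level d h \<and> j \<in> {first_child d h i..<first_child d h i + down_degree d i})"

definition greedy_verts :: "nat list \<Rightarrow> nat set" where
  "greedy_verts d = {..<length d}"

definition greedy_edges :: "nat list \<Rightarrow> (nat \<times> nat) set" where
  "greedy_edges d = {(i, j). greedy_child d i j \<or> greedy_child d j i}"

end

theory Submission
  imports Defs
begin

text \<open>
  In BFS numbering the children of \<open>i\<close> form the interval from \<open>c i\<close> to \<open>c (i + 1)\<close>, where
  \<open>c i = 1 + (\<Sum>j<i. down_degree d j)\<close>. Hence the levels and the levels of the branch hanging from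
  vertex \<open>1\<close> are delimited by iterates of \<open>c\<close>, and these grow along the majorization order. In a
  greedy tree \<open>ecc v\<close> is the level of \<open>v\<close> plus the height, minus one exactly if both \<open>v\<close> and the
  last vertex lie in the branch of vertex \<open>1\<close>. From this the eccentricities can be compared index
  by index.
\<close>

section \<open>The number of edges of a tree\<close>

text \<open>Take an end \<open>x\<close> of a longest path. By maximality its neighbours lie on the
  path, and acyclicity leaves only the second vertex.\<close>

lemma tree_leaf:
  assumes t: "tree V E" and c2: "card V \<ge> 2"
  obtains x y where "x \<in> V" "y \<in> V" "x \<noteq> y" "{u. (x, u) \<in> E} = {y}"
proof -
  from t have fin: "finite V" and EV: "E \<subseteq> V \<times> V" and sym: "sym E" and irr: "irrefl E"
    and conn: "\<forall>u\<in>V. \<forall>v\<in>V. (u, v) \<in> E\<^sup>*" and ne: "V \<noteq> {}" and acyc: "\<nexists>c. graph_cycle E c"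
    by (auto simp: tree_def simple_graph_def graph_connected_def)
  define P where "P xs \<longleftrightarrow> distinct xs \<and> set xs \<subseteq> V \<and> xs \<noteq> [] \<and>
    (\<forall>i. Suc i < length xs \<longrightarrow> (xs ! i, xs ! Suc i) \<in> E)" for xs
  obtain v0 where "v0 \<in> V" using ne by auto
  then have "P [v0]" by (simp add: P_def)
  moreover have "length xs \<le> card V" if "P xs" for xs
    using that fin by (metis P_def card_mono distinct_card)
  ultimately obtain xs where P: "P xs" and max: "\<And>ys. P ys \<Longrightarrow> length ys \<le> length xs"
    using ex_has_greatest_nat[of P "[v0]" length "Suc (card V)"] by (auto simp: less_Suc_eq_le)
  from P obtain x zs where xs: "xs = x # zs" by (cases xs) (auto simp: P_def)
  with P have xV: "x \<in> V" by (auto simp: P_def)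
  have nbr_in: "u \<in> set xs" if "(x, u) \<in> E" for u
  proof (rule ccontr)
    assume "u \<notin> set xs"
    moreover have "u \<in> V" "(u, x) \<in> E" using that EV sym by (auto dest: symD)
    ultimately have "P (u # xs)"
      using P by (auto simp: P_def xs nth_Cons split: nat.splits)
    from max[OF this] show False by simp
  qed
  have nbr_idx: "u = xs ! 1" if xu: "(x, u) \<in> E" for u
  proof -
    obtain i where i: "i < length xs" "u = xs ! i" using nbr_in[OF xu] by (auto simp: in_set_conv_nth)
    have "i \<noteq> 0" using xu irr i xs by (cases i) (auto simp: irrefl_def)
    moreover have "\<not> i \<ge> 2"
    proof
      assume i2: "i \<ge> 2"
      \<comment> \<open>The path from \<open>x\<close> to \<open>u\<close> has at least three
        vertices, so the edge back to \<open>x\<close> closes it to a cycle.\<close>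
      have "last (take (Suc i) xs) = u" using i by (simp add: take_Suc_conv_app_nth)
      moreover have "hd (take (Suc i) xs) = x" by (simp add: xs)
      moreover have "(u, x) \<in> E" using xu sym by (auto dest: symD)
      ultimately have "graph_cycle E (take (Suc i) xs)"
        using P i i2 by (auto simp: graph_cycle_def P_def)
      with acyc show False by blast
    qed
    ultimately have "i = 1" by simp
    with i show ?thesis by simp
  qed
  obtain v where "v \<in> V" "v \<noteq> x"
    using c2 xV fin by (metis card_le_Suc0_iff_eq not_less_eq_eq numeral_2_eq_2)
  then obtain u where u: "(x, u) \<in> E" using conn xV by (metis converse_rtranclE)
  show thesis
  proof
    show "x \<in> V" by fact
    show "u \<in> V" using u EV by auto
    show "x \<noteq> u" using u irr by (auto simp: irrefl_def)
    show "{w. (x, w) \<in> E} = {u}" using nbr_idx u by (metis (mono_tags, lifting) Collect_cong singleton_conv)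
  qed
qed

lemma tree_remove_leaf:
  assumes t: "tree V E" and xy: "y \<in> V" "x \<noteq> y" "{u. (x, u) \<in> E} = {y}"
  shows "tree (V - {x}) (E - {(x, y), (y, x)})"
proof -
  let ?E = "E - {(x, y), (y, x)}"
  from t have fin: "finite V" and EV: "E \<subseteq> V \<times> V" and sym: "sym E" and irr: "irrefl E"
    and conn: "\<forall>u\<in>V. \<forall>v\<in>V. (u, v) \<in> E\<^sup>*" and acyc: "\<nexists>c. graph_cycle E c"
    by (auto simp: tree_def simple_graph_def graph_connected_def)
  have x1: "(x, u) \<in> E \<longleftrightarrow> u = y" for u using xy(3) by auto
  have x2: "(u, x) \<in> E \<longleftrightarrow> u = y" for u using x1 sym by (metis symD)
  have "simple_graph (V - {x}) ?E"
    unfolding simple_graph_def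
  proof (intro conjI)
    show "finite (V - {x})" using fin by simp
    show "?E \<subseteq> (V - {x}) \<times> (V - {x})" using EV x1 x2 by auto
    show "sym ?E" using sym by (auto simp: sym_def)
    show "irrefl ?E" using irr by (auto simp: irrefl_def)
  qed
  moreover have "graph_connected (V - {x}) ?E"
    unfolding graph_connected_def
  proof (intro conjI ballI)
    show "V - {x} \<noteq> {}" using xy by auto
    \<comment> \<open>Retracting \<open>x\<close> to its only neighbour \<open>y\<close> turns a
      walk through \<open>x\<close> into one that avoids it.\<close>
    define f where "f v = (if v = x then y else v)" for v
    fix u v assume uv: "u \<in> V - {x}" "v \<in> V - {x}"
    then have "(u, v) \<in> E\<^sup>*" using conn by auto
    then have "(f u, f v) \<in> ?E\<^sup>*"
    proof (induction rule: rtrancl_induct)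
      case (step a b)
      have "(f a, f b) \<in> ?E\<^sup>*"
      proof (cases "a = x \<or> b = x")
        case True
        then show ?thesis using step(2) x1 x2 by (auto simp: f_def)
      next
        case False
        then show ?thesis using step(2) by (auto simp: f_def)
      qed
      with step.IH show ?case by (rule rtrancl_trans)
    qed simp
    then show "(u, v) \<in> ?E\<^sup>*" using uv by (simp add: f_def)
  qed
  moreover have "\<nexists>c. graph_cycle ?E c" using acyc by (auto simp: graph_cycle_def)
  ultimately show ?thesis by (simp add: tree_def)
qed

text \<open>Removing a leaf takes away one vertex and two pairs: a symmetric relation holds every
  edge in both directions, hence the factor 2.\<close>

lemma tree_card_edges:
  assumes "tree V E"
  shows "card E = 2 * (card V - 1)"
  using assms
proof (induction "card V" arbitrary: V E rule: less_induct)
  case less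
  then have fin: "finite V" and EV: "E \<subseteq> V \<times> V" and sym: "sym E" and irr: "irrefl E" and ne: "V \<noteq> {}"
    by (auto simp: tree_def simple_graph_def graph_connected_def)
  show ?case
  proof (cases "card V \<ge> 2")
    case True
    obtain x y where xy: "x \<in> V" "y \<in> V" "x \<noteq> y" "{u. (x, u) \<in> E} = {y}"
      using tree_leaf[OF less.prems True] by blast
    have e: "(x, y) \<in> E" "(y, x) \<in> E" using xy(4) sym by (auto dest: symD)
    have finE: "finite E" using EV fin by (meson finite_SigmaI finite_subset)
    have "card (V - {x}) < card V" using fin xy(1) by (rule card_Diff1_less)
    from less.hyps[OF this tree_remove_leaf[OF less.prems xy(2-4)]]
    have "card (E - {(x, y), (y, x)}) = 2 * (card V - 1 - 1)" using fin xy by simp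
    moreover have "card (E - {(x, y), (y, x)}) = card E - 2"
      using e xy(3) finE by (subst card_Diff_subset) auto
    moreover have "card E \<ge> 2"
      using card_mono[OF finE, of "{(x, y), (y, x)}"] e xy(3) by auto
    ultimately show ?thesis using True by simp
  next
    case False
    then have "card V = 1" using ne fin by (metis One_nat_def Suc_leI card_gt_0_iff le_antisym not_less_eq_eq numeral_2_eq_2)
    then obtain v where "V = {v}" by (auto simp: card_1_singleton_iff)
    then have "E = {}" using EV irr by (auto simp: irrefl_def)
    then show ?thesis using \<open>card V = 1\<close> by simp
  qed
qed

lemma tree_degree_pos:
  assumes t: "tree V E" and c2: "card V \<ge> 2" and v: "v \<in> V"
  shows "degree E v > 0"
proof -
  from t have fin: "finite V" and EV: "E \<subseteq> V \<times> V" and conn: "\<forall>u\<in>V. \<forall>v\<in>V. (u, v) \<in> E\<^sup>*"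
    by (auto simp: tree_def simple_graph_def graph_connected_def)
  obtain w where "w \<in> V" "w \<noteq> v"
    using c2 v fin by (metis card_le_Suc0_iff_eq not_less_eq_eq numeral_2_eq_2)
  then obtain u where "(v, u) \<in> E" using conn v by (metis converse_rtranclE)
  moreover have "{u. (v, u) \<in> E} \<subseteq> V" using EV by auto
  then have "finite {u. (v, u) \<in> E}" using fin by (rule finite_subset)
  ultimately show ?thesis by (auto simp: degree_def card_gt_0_iff)
qed

lemma sum_degree:
  assumes "simple_graph V E"
  shows "(\<Sum>v\<in>V. degree E v) = card E"
proof -
  from assms have fin: "finite V" and EV: "E \<subseteq> V \<times> V" by (auto simp: simple_graph_def)
  have "E = (SIGMA v:V. {u. (v, u) \<in> E})" using EV by auto
  moreover have "finite {u. (v, u) \<in> E}" for v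
  proof (rule finite_subset)
    show "{u. (v, u) \<in> E} \<subseteq> V" using EV by auto
  qed (rule fin)
  ultimately show ?thesis using card_SigmaI[OF fin, of "\<lambda>v. {u. (v, u) \<in> E}"]
    by (simp add: degree_def)
qed

text \<open>All that the comparison of greedy trees takes from a realizing tree. The last fact
  excludes the single vertex, whose degree is 0.\<close>

lemma tree_degree_sequenceD:
  assumes "tree_degree_sequence d"
  shows "length d \<ge> 1" "sum_list d = 2 * (length d - 1)"
    "length d \<ge> 2 \<Longrightarrow> x \<in> set d \<Longrightarrow> x > 0"
proof -
  obtain V :: "nat set" and E where t: "tree V E"
    and d: "image_mset (degree E) (mset_set V) = mset d"
    using assms by (auto simp: tree_degree_sequence_def)
  from t have fin: "finite V" and ne: "V \<noteq> {}" and sg: "simple_graph V E"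
    by (auto simp: tree_def simple_graph_def graph_connected_def)
  have len: "length d = card V" using d by (metis size_image_mset size_mset size_mset_set)
  show "length d \<ge> 1" using len ne fin by (simp add: Suc_le_eq card_gt_0_iff)
  have "sum_list d = (\<Sum>v\<in>V. degree E v)"
    by (metis d sum_mset_sum_list sum_unfold_sum_mset)
  then show "sum_list d = 2 * (length d - 1)"
    using sum_degree[OF sg] tree_card_edges[OF t] len by simp
  assume "length d \<ge> 2" "x \<in> set d"
  moreover from this obtain v where "v \<in> V" "x = degree E v"
    using d fin by (metis finite_set_mset_mset_set imageE set_image_mset set_mset_mset)
  ultimately show "x > 0" using tree_degree_pos[OF t] len by simp
qed

section \<open>Levels of a greedy tree\<close>

text \<open>\<open>Suc\<close> counts the root, which is nobody's child. In contrast to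
  \<open>first_child\<close>, no level enters.\<close>

definition child_start :: "nat list \<Rightarrow> nat \<Rightarrow> nat" where
  "child_start d i = Suc (\<Sum>j<i. down_degree d j)"

text \<open>
  Vertex \<open>1\<close> and its descendants form a branch; \<open>branch_end d h\<close> bounds the part of it that lies on
  level \<open>Suc h\<close>.
\<close>

definition branch_end :: "nat list \<Rightarrow> nat \<Rightarrow> nat" where
  "branch_end d h = (child_start d ^^ h) 2"

definition vertex_level :: "nat list \<Rightarrow> nat \<Rightarrow> nat" where
  "vertex_level d v = (LEAST h. v < level_start d (Suc h))"

text \<open>The branch is the leftmost part of every level, so an upper bound describes it.
  \<open>0 < v\<close> rules out the root, where the truncated subtraction would give the bound
  2.\<close>

definition first_branch :: "nat list \<Rightarrow> nat \<Rightarrow> bool" where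
  "first_branch d v \<longleftrightarrow> 0 < v \<and> v < branch_end d (vertex_level d v - 1)"

lemma child_start_mono: "i \<le> j \<Longrightarrow> child_start d i \<le> child_start d j"
  unfolding child_start_def by (auto intro!: sum_mono2)

lemma child_start_Suc [simp]: "child_start d (Suc i) = child_start d i + down_degree d i"
  by (simp add: child_start_def)

lemma child_start_0 [simp]: "child_start d 0 = 1"
  by (simp add: child_start_def)

lemma child_start_add:
  "i \<le> j \<Longrightarrow> child_start d i + (\<Sum>k = i..<j. down_degree d k) = child_start d j"
  by (induction j rule: dec_induct) (simp_all add: sum.atLeastLessThan_Suc)

lemma child_start_strict:
  assumes "down_degree d i > 0" "i < j"
  shows "child_start d i < child_start d j"
proof -
  have "child_start d i < child_start d (Suc i)" using assms by simp
  also have "\<dots> \<le> child_start d j" using assms by (intro child_start_mono) simp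
  finally show ?thesis .
qed

lemma branch_end_0 [simp]: "branch_end d 0 = 2"
  by (simp add: branch_end_def)

lemma branch_end_Suc [simp]: "branch_end d (Suc h) = child_start d (branch_end d h)"
  by (simp add: branch_end_def)

lemma level_start_mono_Suc: "level_start d h \<le> level_start d (Suc h)"
  by (cases h) auto

lemma level_start_mono: "h \<le> k \<Longrightarrow> level_start d h \<le> level_start d k"
  by (rule lift_Suc_mono_le[of "level_start d"]) (rule level_start_mono_Suc)

text \<open>The defining sums over single levels telescope. Level boundaries thereby become iterates
  of \<open>child_start\<close> from 0, just as branch ends are its iterates from 2.\<close>

lemma level_start_Suc_eq: "level_start d (Suc h) = child_start d (level_start d h)"
proof (induction h)
  case (Suc h)
  have "level_start d (Suc (Suc h)) = child_start d (level_start d h) +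
      (\<Sum>k = level_start d h..<level_start d (Suc h). down_degree d k)"
    using Suc by simp
  also have "\<dots> = child_start d (level_start d (Suc h))"
    by (rule child_start_add) (rule level_start_mono_Suc)
  finally show ?case .
qed simp

declare level_start.simps(3) [simp del]

lemma vertex_levelI:
  assumes "level_start d h \<le> v" "v < level_start d (Suc h)"
  shows "vertex_level d v = h"
  unfolding vertex_level_def
proof (rule Least_equality)
  fix k assume "v < level_start d (Suc k)"
  then show "h \<le> k" using assms(1) level_start_mono[of "Suc k" h d] by (meson leD leI le_trans not_less_eq_eq)
qed (rule assms)

lemma first_child_eq: "level_start d h \<le> i \<Longrightarrow> first_child d h i = child_start d i"
  by (simp add: first_child_def level_start_Suc_eq child_start_add)

text \<open>Links prefix sums, hence majorization, to \<open>child_start\<close>. A degree exceeds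
  the down-degree by one except at the root, so the prefix sum is
  \<open>(child_start d k - 1) + (k - 1)\<close>.\<close>

lemma sum_list_take_eq_child_start:
  assumes "\<And>x. x \<in> set d \<Longrightarrow> x > 0" "0 < k" "k \<le> length d"
  shows "sum_list (take k d) + 2 = child_start d k + k"
  using assms(2,3)
proof (induction k)
  case (Suc k)
  show ?case
  proof (cases "k = 0")
    case True
    then show ?thesis using Suc.prems by (cases d) (auto simp: down_degree_def)
  next
    case False
    have "d ! k > 0" using Suc.prems assms(1) by simp
    then show ?thesis using Suc False by (simp add: take_Suc_conv_app_nth down_degree_def)
  qed
qed simp

text \<open>What is kept of a tree degree sequence on at least two vertices. Positive entries make
  the subtraction in \<open>down_degree\<close> exact.\<close>

locale greedy_tree =
  fixes d :: "nat list"
  assumes len: "length d \<ge> 2"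
    and noninc: "non_increasing d"
    and pos: "\<And>x. x \<in> set d \<Longrightarrow> x > 0"
    and sum: "sum_list d = 2 * (length d - 1)"
begin

abbreviation "n \<equiv> length d"
abbreviation "L \<equiv> level_start d"
abbreviation "c \<equiv> child_start d"
abbreviation "dd \<equiv> down_degree d"
abbreviation "lev \<equiv> vertex_level d"
abbreviation "E \<equiv> greedy_edges d"

section \<open>Down-degrees and the growth of \<open>child_start\<close>\<close>

lemma nth_antimono: "i \<le> j \<Longrightarrow> j < n \<Longrightarrow> d ! j \<le> d ! i"
  using noninc by (cases "i = j") (auto simp: non_increasing_def sorted_wrt_iff_nth_less)

lemma down_degree_antimono: "i \<le> j \<Longrightarrow> j < n \<Longrightarrow> dd j \<le> dd i"
  using nth_antimono[of i j] by (auto simp: down_degree_def)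

text \<open>The degree sum \<open>2 * (n - 1)\<close> leaves down-degrees of total
  \<open>n - 1\<close>, one for each vertex other than the root.\<close>

lemma child_start_length [simp]: "c n = n"
proof -
  have "sum_list d + 2 = c n + n"
    using sum_list_take_eq_child_start[of d n, OF pos] len by (cases "d = []") auto
  then show ?thesis using len sum by simp
qed

lemma child_start_le: "i \<le> n \<Longrightarrow> c i \<le> n"
  using child_start_mono[of i "length d" d] by simp

text \<open>If \<open>dd i\<close> were 0, all later down-degrees would vanish by monotonicity, and
  \<open>c a\<close> would already equal \<open>c n = n\<close>.\<close>

lemma down_degree_pos:
  assumes "c a < n" "i \<le> a"
  shows "dd i > 0"
proof (rule ccontr)
  assume i0: "\<not> dd i > 0"
  have an: "a < n" using assms(1) child_start_mono[of "length d" a d] child_start_length by linarith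
  have "(\<Sum>k = a..<n. dd k) = 0"
  proof (rule sum.neutral, intro ballI)
    fix k assume "k \<in> {a..<n}"
    then show "dd k = 0" using down_degree_antimono[of i k] i0 assms(2) by simp
  qed
  then show False using child_start_add[of a "length d" d] an assms(1) by simp
qed

text \<open>If \<open>c i \<le> i < n\<close>, then children remain to be assigned from
  \<open>i\<close> on, so the \<open>i\<close> earlier down-degrees are positive and
  \<open>c i \<ge> i + 1\<close>.\<close>

lemma less_child_start: "i < n \<Longrightarrow> i < c i"
proof (rule ccontr)
  assume "i < n" "\<not> i < c i"
  then have "dd j > 0" if "j < i" for j using down_degree_pos[of i j] that by simp
  then have "(\<Sum>j<i. 1) \<le> (\<Sum>j<i. dd j)" by (intro sum_mono) (simp add: Suc_le_eq)
  then show False using \<open>\<not> i < c i\<close> by (simp add: child_start_def)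
qed

section \<open>Level boundaries and the level of a vertex\<close>

lemma level_start_le: "L h \<le> n"
  using len by (induction h) (auto simp: level_start_Suc_eq child_start_le)

lemma branch_end_le: "branch_end d h \<le> n"
  using len by (induction h) (auto simp: child_start_le)

text \<open>While vertices remain, no level is empty, so the boundaries advance by at least one.
  This gives every vertex a level.\<close>

lemma min_le_level_start: "min h n \<le> L h"
proof (induction h)
  case (Suc h)
  show ?case
  proof (cases "L h < n")
    case True
    then show ?thesis using less_child_start[OF True] Suc by (simp add: level_start_Suc_eq)
  next
    case False
    then show ?thesis using level_start_mono_Suc[of d h] by simp
  qed
qed simp

lemma vertex_level_bounds:
  assumes "v < n"
  shows "L (lev v) \<le> v" "v < L (Suc (lev v))"
proof -
  have "v < L (Suc v)" using min_le_level_start[of "Suc v"] assms by simp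
  then show 1: "v < L (Suc (lev v))" unfolding vertex_level_def by (rule LeastI)
  show "L (lev v) \<le> v"
  proof (cases "lev v")
    case (Suc h)
    then show ?thesis
      using not_less_Least[of h "\<lambda>h. v < L (Suc h)"] by (simp add: vertex_level_def)
  qed simp
qed

lemma vertex_level_mono: "u \<le> v \<Longrightarrow> v < n \<Longrightarrow> lev u \<le> lev v"
  using vertex_level_bounds[of v] unfolding vertex_level_def[of d u] by (intro Least_le) simp

lemma vertex_level_0 [simp]: "lev 0 = 0"
  by (rule vertex_levelI) auto

lemma vertex_level_pos: "0 < v \<Longrightarrow> v < n \<Longrightarrow> 0 < lev v"
  using vertex_level_bounds[of v] by (cases "lev v") auto

section \<open>Parents, children and the first branch\<close>

lemma greedy_child_iff:
  "greedy_child d i j \<longleftrightarrow> i < n \<and> c i \<le> j \<and> j < c (Suc i)"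
proof
  assume "greedy_child d i j"
  then obtain h where h: "L h \<le> i" "i < L (Suc h)" "first_child d h i \<le> j"
    "j < first_child d h i + dd i"
    by (auto simp: greedy_child_def level_def)
  then show "i < n \<and> c i \<le> j \<and> j < c (Suc i)"
    using level_start_le[of "Suc h"] by (simp add: first_child_eq)
next
  assume "i < n \<and> c i \<le> j \<and> j < c (Suc i)"
  then show "greedy_child d i j"
    using vertex_level_bounds[of i]
    by (auto simp: greedy_child_def level_def first_child_eq intro!: exI[of _ "lev i"])
qed

text \<open>For the last fact, the branch end on the next level is \<open>c\<close> of the current
  one, so no interval of children straddles it. The root is exempt: of its children only vertex
  \<open>1\<close> is in the branch.\<close>

lemma greedy_childD:
  assumes "greedy_child d i j"
  shows "i < j" "j < n" "lev j = Suc (lev i)" "i \<noteq> 0 \<Longrightarrow> first_branch d j = first_branch d i"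
proof -
  from assms have ij: "i < n" "c i \<le> j" "j < c (Suc i)" unfolding greedy_child_iff by auto
  show "i < j" using less_child_start[of i] ij by simp
  show "j < n" using child_start_le[of "Suc i"] ij by simp
  have "L (Suc (lev i)) \<le> c i"
    unfolding level_start_Suc_eq using vertex_level_bounds[of i] ij by (intro child_start_mono) simp
  moreover have "c (Suc i) \<le> L (Suc (Suc (lev i)))"
    unfolding level_start_Suc_eq[of d "Suc _"] using vertex_level_bounds[of i] ij
    by (intro child_start_mono) simp
  ultimately show lj: "lev j = Suc (lev i)" using ij by (intro vertex_levelI) auto
  assume i0: "i \<noteq> 0"
  then obtain h where h: "lev i = Suc h" using vertex_level_pos[of i] ij by (cases "lev i") auto
  have "j < c (branch_end d h)" if "i < branch_end d h"
    using child_start_mono[of "Suc i" "branch_end d h" d] that ij by simp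
  moreover have "c (branch_end d h) \<le> j" if "branch_end d h \<le> i"
    using child_start_mono[of "branch_end d h" i d] that ij by simp
  ultimately show "first_branch d j = first_branch d i"
    using lj h i0 \<open>i < j\<close> by (auto simp: first_branch_def not_less[symmetric])
qed

lemma parent_exists:
  assumes "0 < j" "j < n"
  obtains i where "greedy_child d i j"
proof -
  \<comment> \<open>The intervals from \<open>c i\<close> to \<open>c (i + 1)\<close> tile the
    vertices from 1 on; the least such \<open>i\<close> picks the interval around
    \<open>j\<close>.\<close>
  define i where "i = (LEAST i. j < c (Suc i))"
  have "j < c (Suc j)" using less_child_start[OF assms(2)] by simp
  then have 1: "j < c (Suc i)" unfolding i_def by (rule LeastI)
  have "i \<le> j" unfolding i_def using \<open>j < c (Suc j)\<close> by (rule Least_le)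
  have "c i \<le> j"
  proof (cases i)
    case 0
    then show ?thesis using assms by simp
  next
    case (Suc k)
    then show ?thesis using not_less_Least[of k "\<lambda>i. j < c (Suc i)"] i_def by (simp del: child_start_Suc)
  qed
  then have "greedy_child d i j" using 1 \<open>i \<le> j\<close> assms unfolding greedy_child_iff by simp
  then show thesis by (rule that)
qed

lemma not_first_branch_0: "\<not> first_branch d 0"
  by (simp add: first_branch_def)

lemma first_branch_level_1:
  assumes "first_branch d v" "lev v = 1"
  shows "v = 1"
  using assms by (simp add: first_branch_def)

section \<open>Eccentricities in a greedy tree\<close>

lemma sym_edges: "sym E"
  by (auto simp: sym_def greedy_edges_def)

lemma walk_sym: "(u, v) \<in> E ^^ k \<Longrightarrow> (v, u) \<in> E ^^ k"
proof (induction k arbitrary: v)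
  case (Suc k)
  then obtain w where "(u, w) \<in> E ^^ k" "(w, v) \<in> E" by auto
  then show ?case using Suc.IH[of w] sym_edges by (meson relpow_Suc_I2 symD)
qed simp

lemma walk_to_root: "v < n \<Longrightarrow> (v, 0) \<in> E ^^ lev v"
proof (induction v rule: less_induct)
  case (less v)
  show ?case
  proof (cases "v = 0")
    case False
    then obtain i where i: "greedy_child d i v" using parent_exists less.prems by blast
    have "(i, 0) \<in> E ^^ lev i" using less.IH[of i] greedy_childD(1,2)[OF i] by simp
    moreover have "(v, i) \<in> E" using i by (simp add: greedy_edges_def)
    ultimately show ?thesis using greedy_childD(3)[OF i] by (metis relpow_Suc_I2)
  qed simp
qed

text \<open>The ancestors of a branch vertex stay in the branch up to level 1, where
  \<open>1\<close> is its only member.\<close>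

lemma walk_to_1:
  assumes "v < n" "first_branch d v"
  shows "(v, 1) \<in> E ^^ (lev v - 1)"
  using assms
proof (induction v rule: less_induct)
  case (less v)
  show ?case
  proof (cases "lev v = 1")
    case True
    then show ?thesis using first_branch_level_1 less.prems by simp
  next
    case False
    have "v \<noteq> 0" using less.prems not_first_branch_0 by metis
    then obtain i where i: "greedy_child d i v" using parent_exists less.prems by blast
    have i0: "i \<noteq> 0" using False greedy_childD(3)[OF i] by (cases "i = 0") auto
    have "(i, 1) \<in> E ^^ (lev i - 1)"
      using less.IH[of i] greedy_childD[OF i] i0 less.prems by simp
    moreover have "(v, i) \<in> E" using i by (simp add: greedy_edges_def)
    ultimately have "(v, 1) \<in> E ^^ Suc (lev i - 1)" by (metis relpow_Suc_I2)
    moreover have "0 < lev i" using vertex_level_pos[of i] greedy_childD[OF i] i0 by simp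
    ultimately show ?thesis using greedy_childD(3)[OF i] by simp
  qed
qed

lemma walk_via_root: "u < n \<Longrightarrow> v < n \<Longrightarrow> (u, v) \<in> E ^^ (lev u + lev v)"
  by (rule relpow_trans[OF walk_to_root walk_sym[OF walk_to_root]])

lemma dist_le: "u < n \<Longrightarrow> v < n \<Longrightarrow> graph_dist E u v \<le> lev u + lev v"
  unfolding graph_dist_def by (intro Least_le walk_via_root)

lemma dist_le_first_branch:
  assumes "u < n" "v < n" "first_branch d u" "first_branch d v"
  shows "graph_dist E u v \<le> (lev u - 1) + (lev v - 1)"
proof -
  have "(u, v) \<in> E ^^ ((lev u - 1) + (lev v - 1))"
    using relpow_trans[OF walk_to_1 walk_sym[OF walk_to_1]] assms by simp
  then show ?thesis unfolding graph_dist_def by (rule Least_le)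
qed

text \<open>
  The level, negated on the first branch, is 1-Lipschitz: the only edge crossing between the two
  sides is the one from the root to vertex \<open>1\<close>.
\<close>

definition signed_level :: "nat \<Rightarrow> int" where
  "signed_level v = (if first_branch d v then - int (lev v) else int (lev v))"

text \<open>The root has value 0 and its children 1 or -1; below the root, parent and child lie on
  the same side, one level apart.\<close>

lemma signed_level_child:
  assumes "greedy_child d i j"
  shows "\<bar>signed_level i - signed_level j\<bar> \<le> 1"
  using greedy_childD[OF assms] not_first_branch_0
  by (cases "i = 0") (auto simp: signed_level_def)

lemma signed_level_walk: "(u, v) \<in> E ^^ k \<Longrightarrow> \<bar>signed_level u - signed_level v\<bar> \<le> int k"
proof (induction k arbitrary: v)
  case (Suc k)
  then obtain w where w: "(u, w) \<in> E ^^ k" "(w, v) \<in> E" by auto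
  have "\<bar>signed_level w - signed_level v\<bar> \<le> 1"
    using w(2) signed_level_child[of w v] signed_level_child[of v w] by (auto simp: greedy_edges_def)
  then show ?case using Suc.IH[OF w(1)] by simp
qed simp

text \<open>Across the two sides \<open>signed_level\<close> differs by exactly
  \<open>lev u + lev v\<close>, and a walk changes it by at most its length.\<close>

lemma dist_ge:
  assumes "u < n" "v < n" "first_branch d u \<noteq> first_branch d v"
  shows "lev u + lev v \<le> graph_dist E u v"
proof -
  have "(u, v) \<in> E ^^ graph_dist E u v"
    unfolding graph_dist_def using walk_via_root[OF assms(1,2)] by (rule LeastI)
  from signed_level_walk[OF this] assms(3) show ?thesis
    by (auto simp: signed_level_def split: if_splits)
qed

text \<open>Both sides are iterates of \<open>c\<close>, from 1 and 2, and \<open>c\<close> keeps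
  them apart as long as down-degrees are positive. So the branch meets every nonempty level below
  the root.\<close>

lemma level_start_less_branch_end: "L (Suc h) < n \<Longrightarrow> L (Suc h) < branch_end d h"
proof (induction h)
  case (Suc h)
  have c: "c (L (Suc h)) < n" using Suc.prems by (simp add: level_start_Suc_eq[of d "Suc h"])
  have "L (Suc h) < n" using level_start_mono_Suc[of d "Suc h"] Suc.prems by simp
  then have "L (Suc h) < branch_end d h" by (rule Suc.IH)
  then have "c (L (Suc h)) < c (branch_end d h)"
    using down_degree_pos[OF c] by (intro child_start_strict) auto
  then show ?case by (simp add: level_start_Suc_eq[of d "Suc h"])
qed simp

text \<open>Dually, every level \<open>h + 1\<close> that is followed by a nonempty one has a vertex
  outside the branch.\<close>

lemma branch_end_less_level_start: "L (Suc (Suc h)) < n \<Longrightarrow> branch_end d h < L (Suc (Suc h))"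
proof (induction h)
  case 0
  \<comment> \<open>If vertex \<open>1\<close> has a child, its degree is at least 2, hence so is
    that of the root, which gives vertex \<open>1\<close> a sibling.\<close>
  then have "c 1 < n" by (simp add: level_start_Suc_eq[of d "Suc 0"])
  then have "dd 1 > 0" by (rule down_degree_pos) simp
  then have "dd 0 \<ge> 2"
    using nth_antimono[of 0 1] len by (simp add: down_degree_def)
  then show ?case by (simp add: level_start_Suc_eq[of d "Suc 0"])
next
  case (Suc h)
  have c: "c (L (Suc (Suc h))) < n" using Suc.prems by (simp add: level_start_Suc_eq[of d "Suc (Suc h)"])
  have "L (Suc (Suc h)) < n" using level_start_mono_Suc[of d "Suc (Suc h)"] Suc.prems by simp
  then have "branch_end d h < L (Suc (Suc h))" by (rule Suc.IH)
  then have "c (branch_end d h) < c (L (Suc (Suc h)))"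
    using down_degree_pos[OF c] by (intro child_start_strict) auto
  then show ?case by (simp add: level_start_Suc_eq[of d "Suc (Suc h)"])
qed

section \<open>The eccentricity formula\<close>

lemma ecc_geI: "u < n \<Longrightarrow> k \<le> graph_dist E u v \<Longrightarrow> k \<le> ecc (greedy_verts d) E v"
  unfolding ecc_def greedy_verts_def
  by (rule order_trans[of _ "graph_dist E u v"]) (auto intro!: Max_ge)

lemma ecc_leI: "(\<And>u. u < n \<Longrightarrow> graph_dist E u v \<le> k) \<Longrightarrow> ecc (greedy_verts d) E v \<le> k"
  unfolding ecc_def greedy_verts_def using len by (subst Max_le_iff) (auto intro!: exI[of _ 0])

text \<open>Being rightmost on the last level, \<open>n - 1\<close> decides whether that whole level
  lies in the branch. If it does, a branch vertex reaches the level without climbing to the root,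
  and its farthest vertices lie outside the branch one level higher.\<close>

lemma ecc_eq:
  assumes v: "v < n"
  shows "ecc (greedy_verts d) E v =
    lev v + lev (n - 1) - (if first_branch d v \<and> first_branch d (n - 1) then 1 else 0)"
proof (rule antisym)
  let ?H = "lev (n - 1)"
  have lastn: "n - 1 < n" using len by simp
  have levH: "lev u \<le> ?H" if "u < n" for u using vertex_level_mono[of u "n - 1"] that by simp
  have Hpos: "0 < ?H" using vertex_level_pos[of "n - 1"] len by simp
  then obtain h where h: "?H = Suc h" by (cases ?H) auto
  have LH: "L (Suc h) \<le> n - 1" "n - 1 < L (Suc (Suc h))"
    using vertex_level_bounds[OF lastn] h by auto
  show "ecc (greedy_verts d) E v \<le>
    lev v + ?H - (if first_branch d v \<and> first_branch d (n - 1) then 1 else 0)"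
  proof (rule ecc_leI)
    fix u assume u: "u < n"
    show "graph_dist E u v \<le>
      lev v + ?H - (if first_branch d v \<and> first_branch d (n - 1) then 1 else 0)"
    proof (cases "first_branch d v \<and> first_branch d (n - 1)")
      case True
      have lv: "0 < lev v" using True vertex_level_pos[OF _ v] by (auto simp: first_branch_def)
      show ?thesis
      proof (cases "first_branch d u")
        case fu: True
        then show ?thesis using dist_le_first_branch[OF u v] True levH[OF u] lv Hpos by simp
      next
        case fu: False
        \<comment> \<open>The whole last level lies in the branch, as its rightmost vertex
          does.\<close>
        have "lev u \<noteq> ?H"
        proof
          assume "lev u = ?H"
          then have "branch_end d h \<le> u"
            using fu vertex_level_bounds(1)[OF u] h Hpos by (cases "u = 0") (auto simp: first_branch_def)
          then show False using True h u by (auto simp: first_branch_def)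
        qed
        then have "lev u < ?H" using levH[OF u] by simp
        then show ?thesis using dist_le[OF u v] by auto
      qed
    next
      case False
      then show ?thesis using dist_le[OF u v] levH[OF u] by auto
    qed
  qed
  show "lev v + ?H - (if first_branch d v \<and> first_branch d (n - 1) then 1 else 0)
    \<le> ecc (greedy_verts d) E v"
  proof (cases "first_branch d v")
    case False
    \<comment> \<open>The far vertex is the leftmost one of the last level, which always belongs to
      the branch.\<close>
    have Ln: "L (Suc h) < n" using LH len by simp
    have le: "lev (L (Suc h)) = Suc h" by (rule vertex_levelI) (use LH in auto)
    have "L (Suc h) > 0" by (simp add: level_start_Suc_eq child_start_def)
    then have "first_branch d (L (Suc h))"
      using level_start_less_branch_end[OF Ln] le by (simp add: first_branch_def)
    then show ?thesis using dist_ge[OF Ln v] False le h by (intro ecc_geI[OF Ln]) simp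
  next
    case True
    show ?thesis
    proof (cases "first_branch d (n - 1)")
      case False
      then show ?thesis using dist_ge[OF lastn v] True by (intro ecc_geI[OF lastn]) simp
    next
      case last: True
      have "\<exists>u<n. \<not> first_branch d u \<and> lev u = h"
      proof (cases h)
        case 0
        then show ?thesis using not_first_branch_0 len by (intro exI[of _ 0]) auto
      next
        case (Suc k)
        \<comment> \<open>The rightmost vertex of level \<open>h\<close>, which the branch does not
          reach.\<close>
        define u where "u = L (Suc (Suc k)) - 1"
        have Ln: "L (Suc (Suc k)) < n" using LH Suc len by simp
        have b: "branch_end d k < L (Suc (Suc k))" by (rule branch_end_less_level_start[OF Ln])
        have "L (Suc k) < n" using level_start_mono_Suc[of d "Suc k"] Ln by simp
        then have "L (Suc k) < branch_end d k" by (rule level_start_less_branch_end)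
        then have "lev u = Suc k" using b unfolding u_def by (intro vertex_levelI) auto
        moreover from this have "\<not> first_branch d u" using b by (auto simp: first_branch_def u_def)
        ultimately show ?thesis using Ln Suc by (intro exI[of _ u]) (auto simp: u_def)
      qed
      then obtain u where u: "u < n" "\<not> first_branch d u" "lev u = h" by blast
      show ?thesis using dist_ge[OF u(1) v] True last u h by (intro ecc_geI[OF u(1)]) simp
    qed
  qed
qed

end

section \<open>Comparison of two greedy trees\<close>

locale greedy_tree_pair = p: greedy_tree p + q: greedy_tree q for p q +
  assumes maj: "majorized_by p q"
begin

lemma length_eq: "length p = length q"
  using maj by (simp add: majorized_by_def)

lemma child_start_le_child_start:
  assumes "i \<le> length p"
  shows "child_start p i \<le> child_start q i"
\<comment> \<open>Majorization compares proper nonempty prefixes; at the two ends both values are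
  fixed, 1 and \<open>length p\<close>.\<close>
proof (cases "i = 0 \<or> i = length p")
  case True
  then show ?thesis using p.child_start_length q.child_start_length length_eq by auto
next
  case False
  then have "sum_list (take i p) \<le> sum_list (take i q)"
    using maj assms by (auto simp: majorized_by_def)
  then show ?thesis
    using sum_list_take_eq_child_start[of p i, OF p.pos] sum_list_take_eq_child_start[of q i, OF q.pos]
      False assms length_eq by simp
qed

text \<open>Compare the two maps \<open>child_start\<close> at the same argument, then use
  monotonicity of the larger one. The comparison holds up to \<open>length p\<close>, which bounds
  all level starts.\<close>

lemma level_start_le_level_start: "level_start p h \<le> level_start q h"
proof (induction h)
  case (Suc h)
  have "level_start p (Suc h) \<le> child_start q (level_start p h)"
    unfolding level_start_Suc_eq by (rule child_start_le_child_start[OF p.level_start_le])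
  also have "\<dots> \<le> level_start q (Suc h)"
    unfolding level_start_Suc_eq by (rule child_start_mono[OF Suc])
  finally show ?case .
qed simp

lemma branch_end_le_branch_end: "branch_end p h \<le> branch_end q h"
proof (induction h)
  case (Suc h)
  have "branch_end p (Suc h) \<le> child_start q (branch_end p h)"
    unfolding branch_end_Suc by (rule child_start_le_child_start[OF p.branch_end_le])
  also have "\<dots> \<le> branch_end q (Suc h)"
    unfolding branch_end_Suc by (rule child_start_mono[OF Suc])
  finally show ?case .
qed simp

lemma vertex_level_ge:
  assumes "v < length p"
  shows "vertex_level q v \<le> vertex_level p v"
  unfolding vertex_level_def[of q]
  using p.vertex_level_bounds(2)[OF assms] level_start_le_level_start less_le_trans
  by (intro Least_le) blast

lemma first_branch_transfer:
  "first_branch p v \<Longrightarrow> vertex_level q v = vertex_level p v \<Longrightarrow> first_branch q v"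
  using branch_end_le_branch_end less_le_trans by (auto simp: first_branch_def)

text \<open>Only the correction by one for \<open>p\<close> could do harm. If it applies, either a
  strictly smaller level in \<open>q\<close> makes up for it, or both levels agree and the
  correction carries over to \<open>q\<close>.\<close>

lemma ecc_ge:
  assumes v: "v < length p"
  shows "ecc (greedy_verts q) (greedy_edges q) v \<le> ecc (greedy_verts p) (greedy_edges p) v"
proof -
  let ?m = "length p - 1"
  have m: "?m < length p" using p.len by simp
  have le: "vertex_level q v \<le> vertex_level p v" "vertex_level q ?m \<le> vertex_level p ?m"
    using vertex_level_ge v m by auto
  show ?thesis
    unfolding p.ecc_eq[OF v] q.ecc_eq[OF v[unfolded length_eq], folded length_eq]
    using le first_branch_transfer[of v] first_branch_transfer[of ?m]
    by (cases "vertex_level q v = vertex_level p v"; cases "vertex_level q ?m = vertex_level p ?m") auto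
qed

end

theorem theorem3p13:
  fixes p' p'' :: "nat list" and n :: nat
  assumes "length p' = n" and "length p'' = n"
    and "tree_degree_sequence p'" and "non_increasing p'"
    and "tree_degree_sequence p''" and "non_increasing p''"
    and "majorized_by p' p''"
  shows "Ecc (greedy_verts p') (greedy_edges p') \<ge> Ecc (greedy_verts p'') (greedy_edges p'')"
proof (cases "n \<ge> 2")
  case True
  interpret greedy_tree_pair p' p''
    using True assms by unfold_locales (auto dest: tree_degree_sequenceD)
  show ?thesis
    unfolding Ecc_def using assms(1,2) ecc_ge
    by (auto simp: greedy_verts_def intro!: sum_mono)
next
  case False
  \<comment> \<open>For a single vertex, equal sums force equal sequences.\<close>
  then have "length p' = 1" "length p'' = 1"
    using tree_degree_sequenceD(1)[OF assms(3)] assms(1,2) by auto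
  then have "p' = p''"
    using assms(7) by (auto simp: majorized_by_def length_Suc_conv)
  then show ?thesis by simp
qed

end
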